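(* Let $S_*$ be the set of minimizers of $f+g$ over $\mathcal{H}$. Let $(x^k)_{k\in\mathbb{N}}$ be generated by the PSS Method with exogenous stepsizes, i.e. $\alpha_k=\beta_k/\eta_k>0$ with $\eta_k:=\max\{1,\|u^k\|\}$ for all $k$, $\sum_{k=0}^\infty\beta_k^2<+\infty$ and $\sum_{k=0}^\infty\beta_k=+\infty$. Let $(f+g)^k_{\rm best}:=\min_{0\le i\le k}(f+g)(x^i)$ and let $\bar x^k:=\frac{1}{\sum_{i=0}^k\alpha_i}\sum_{i=0}^k\alpha_i x^i$ be the ergodic sequence. If $S_*\neq\emptyset$, then, for all $k\in\mathbb{N}$, $$(f+g)^k_{\rm best}-\min_{x\in\mathcal{H}}(f+g)(x)\le\zeta\,\frac{[\operatorname{dist}(x^0,S_* )]^2+(1+2\rho+\rho^2)\sum_{i=0}^k\beta_i^2}{2\sum_{i=0}^k\beta_i}$$ and $$(f+g)(\bar x^k)-\min_{x\in\mathcal{H}}(f+g)(x)\le\zeta\,\frac{[\operatorname{dist}(x^0,S_* )]^2+(1+2\rho+\rho^2)\sum_{i=0}^k\beta_i^2}{2\sum_{i=0}^k\beta_i},$$ where $\zeta>0$ and $\rho\ge0$ are as in Assumptions A1 and A2, respectively ($\zeta$ being the bound given by A1 for a bounded closed set $V\subseteq\operatorname{dom}(g)$ containing the iterates $x^k$).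
   Context: Setting. $\mathcal{H}$ is a nontrivial real Hilbert space; $f,g:\mathcal{H}\to\mathbb{R}\cup\{+\infty\}$ are proper, lower semicontinuous and convex, with $\operatorname{dom}(g)\subseteq\operatorname{dom}(f)$, where $\operatorname{dom}(h)=\{x: h(x)<+\infty\}$. $\partial$ denotes the convex subdifferential, $\mathbb{N}=\{0,1,2,\dots\}$, $\mathbb{B}[0;r]$ is the closed ball of radius $r$ centered at $0$, and $\operatorname{dist}(x,S)=\inf_{y\in S}\|x-y\|$. Standing assumptions: A1: $\partial f$ is bounded on bounded sets of $\operatorname{dom}(g)$, i.e. there is $\zeta>0$ such that $\partial f(x)\subseteq\mathbb{B}[0;\zeta]$ for all $x\in V$, where $V$ is any bounded and closed subset of $\operatorname{dom}(g)$. A2: there is $\rho\ge 0$ such that $\partial g(x)\cap\mathbb{B}[0;\rho]\ne\emptyset$ for all $x\in\operatorname{dom}(g)$. For $\alpha>0$, $\operatorname{prox}_{\alpha g}(z)$ is the unique minimizer over $y\in\mathcal{H}$ of $\alpha g(y)+\frac12\|y-z\|^2$. PSS Method (Proximal Subgradient Splitting Method): take $x^0\in\operatorname{dom}(g)$ and, for $k\in\mathbb{N}$, set $x^{k+1}=\operatorname{prox}_{\alpha_k g}(x^k-\alpha_k u^k)$, where $u^k\in\partial f(x^k)$ and the stepsize $\alpha_k$ is positive. The method stops if $x^{k+1}=x^k$; it is assumed that it never stops, so that $(x^k)_{k\in\mathbb{N}}$ is an infinite sequence.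
   Formalization: The bound ζ from A1 is required to satisfy ζ ≥ 1 (it can always be enlarged to max{1,ζ}); with ζ < 1 the printed inequalities can fail, e.g. f = 0, g the Huber function on ℝ, ρ = 1, x⁰ = 10, β₀ = 1, ζ = 0.1, k = 0. *)

theory Defs
  imports "HOL-Analysis.Analysis"
begin

text \<open>Functions with values in the reals extended by \<open>+\<infinity>\<close> are modelled as
  \<^typ>\<open>ereal\<close>-valued; the value \<open>-\<infinity>\<close> is excluded by properness.\<close>

definition edom :: "('a \<Rightarrow> ereal) \<Rightarrow> 'a set" where
  "edom h = {x. h x < \<infinity>}"

definition proper_fun :: "('a \<Rightarrow> ereal) \<Rightarrow> bool" where
  "proper_fun h \<longleftrightarrow> (\<forall>x. h x \<noteq> -\<infinity>) \<and> edom h \<noteq> {}"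

definition lsc_fun :: "('a::topological_space \<Rightarrow> ereal) \<Rightarrow> bool" where
  "lsc_fun h \<longleftrightarrow> (\<forall>x. h x \<le> Liminf (at x) h)"

definition convex_fun :: "('a::real_vector \<Rightarrow> ereal) \<Rightarrow> bool" where
  "convex_fun h \<longleftrightarrow>
     (\<forall>x y. \<forall>t\<in>{0<..<1::real}.
        h ((1 - t) *\<^sub>R x + t *\<^sub>R y) \<le> ereal (1 - t) * h x + ereal t * h y)"

text \<open>For proper \<open>h\<close> this is empty at every point outside \<open>edom h\<close>.\<close>

definition subdiff :: "('a::real_inner \<Rightarrow> ereal) \<Rightarrow> 'a \<Rightarrow> 'a set" where
  "subdiff h x = {u. \<forall>y. h x + ereal (u \<bullet> (y - x)) \<le> h y}"

definition minimizers :: "('a \<Rightarrow> ereal) \<Rightarrow> 'a set" where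
  "minimizers h = {x. \<forall>y. h x \<le> h y}"

definition prox :: "real \<Rightarrow> ('a::real_inner \<Rightarrow> ereal) \<Rightarrow> 'a \<Rightarrow> 'a" where
  "prox \<alpha> g z =
     (THE y. y \<in> minimizers (\<lambda>w. ereal \<alpha> * g w + ereal (1/2 * (norm (w - z))\<^sup>2)))"

definition subdiff_bound :: "('a::real_inner \<Rightarrow> ereal) \<Rightarrow> 'a set \<Rightarrow> real \<Rightarrow> bool" where
  "subdiff_bound f V \<zeta> \<longleftrightarrow> \<zeta> > 0 \<and> (\<forall>x\<in>V. subdiff f x \<subseteq> cball 0 \<zeta>)"

text \<open>The bound on the subgradients of \<open>f\<close> depends on the bounded set. It can always be
  enlarged, so requiring it to be at least \<open>1\<close> excludes no function \<open>f\<close>.\<close>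

definition assumption_A1 :: "('a::real_inner \<Rightarrow> ereal) \<Rightarrow> ('a \<Rightarrow> ereal) \<Rightarrow> bool" where
  "assumption_A1 f g \<longleftrightarrow>
     (\<forall>V. bounded V \<and> closed V \<and> V \<subseteq> edom g \<longrightarrow> (\<exists>\<zeta>. subdiff_bound f V \<zeta>))"

definition assumption_A2 :: "('a::real_inner \<Rightarrow> ereal) \<Rightarrow> real \<Rightarrow> bool" where
  "assumption_A2 g \<rho> \<longleftrightarrow> \<rho> \<ge> 0 \<and> (\<forall>x\<in>edom g. subdiff g x \<inter> cball 0 \<rho> \<noteq> {})"

text \<open>The last conjunct says that the stopping test never succeeds.\<close>

definition pss_method ::
  "('a::real_inner \<Rightarrow> ereal) \<Rightarrow> ('a \<Rightarrow> ereal) \<Rightarrow> (nat \<Rightarrow> real) \<Rightarrow> (nat \<Rightarrow> 'a) \<Rightarrow> (nat \<Rightarrow> 'a) \<Rightarrow> bool"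
where
  "pss_method f g \<alpha> u x \<longleftrightarrow>
     x 0 \<in> edom g \<and>
     (\<forall>k. \<alpha> k > 0 \<and> u k \<in> subdiff f (x k) \<and>
          x (Suc k) = prox (\<alpha> k) g (x k - \<alpha> k *\<^sub>R u k) \<and>
          x (Suc k) \<noteq> x k)"

definition exogenous_stepsizes ::
  "(nat \<Rightarrow> real) \<Rightarrow> (nat \<Rightarrow> real) \<Rightarrow> (nat \<Rightarrow> 'a::real_normed_vector) \<Rightarrow> bool" where
  "exogenous_stepsizes \<alpha> \<beta> u \<longleftrightarrow>
     (\<forall>k. \<alpha> k = \<beta> k / max 1 (norm (u k)) \<and> \<alpha> k > 0) \<and>
     summable (\<lambda>k. (\<beta> k)\<^sup>2) \<and>
     filterlim (\<lambda>n. \<Sum>k<n. \<beta> k) at_top sequentially"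

definition best_value :: "('a \<Rightarrow> ereal) \<Rightarrow> (nat \<Rightarrow> 'a) \<Rightarrow> nat \<Rightarrow> ereal" where
  "best_value h x k = Min ((\<lambda>i. h (x i)) ` {0..k})"

definition ergodic :: "(nat \<Rightarrow> real) \<Rightarrow> (nat \<Rightarrow> 'a::real_vector) \<Rightarrow> nat \<Rightarrow> 'a" where
  "ergodic \<alpha> x k = (1 / (\<Sum>i=0..k. \<alpha> i)) *\<^sub>R (\<Sum>i=0..k. \<alpha> i *\<^sub>R x i)"

end

theory Submission
  imports Defs
begin

text \<open>The optimality condition of the proximal step gives
  \<open>z - p \<in> \<alpha> \<partial>g p\<close> for \<open>p = prox \<alpha> g z\<close>. Combining it with the
  subgradient inequalities of \<open>f\<close> and \<open>g\<close> at \<open>x k\<close> (the latter with the bounded subgradient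
  of A2) and absorbing the cross terms into \<open>\<parallel>x k - x (Suc k)\<parallel>\<^sup>2\<close> yields, for every \<open>s\<close> in the domain
  of \<open>g\<close>,
  \<open>\<parallel>x (Suc k) - s\<parallel>\<^sup>2 \<le> \<parallel>x k - s\<parallel>\<^sup>2 + 2 \<alpha> k ((f+g) s - (f+g) (x k)) + ((1 + \<rho>) \<beta> k)\<^sup>2\<close>.
  Telescoping with \<open>s\<close> a minimizer, using \<open>\<alpha> k \<ge> \<beta> k / \<zeta>\<close>, and Jensen's inequality for
  the ergodic sequence give both rates.\<close>

section \<open>Real-valued calculus on effective domains\<close>

lemma edom_real:
  assumes "proper_fun h" "y \<in> edom h"
  shows "h y = ereal (real_of_ereal (h y))"
  using assms by (cases "h y") (auto simp: proper_fun_def edom_def)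

text \<open>A finite right-hand side in the convexity inequality forces a finite left-hand side, so
  the domain is convex as well. This moves the later estimates from extended to real
  arithmetic.\<close>

lemma convex_fun_real:
  assumes "proper_fun h" "convex_fun h"
  shows "convex_on (edom h) (\<lambda>y. real_of_ereal (h y))"
proof -
  have *: "(1 - t) *\<^sub>R a + t *\<^sub>R b \<in> edom h \<and>
      real_of_ereal (h ((1 - t) *\<^sub>R a + t *\<^sub>R b))
        \<le> (1 - t) * real_of_ereal (h a) + t * real_of_ereal (h b)"
    if "a \<in> edom h" "b \<in> edom h" "0 < t" "t < 1" for a b t
  proof -
    have "h ((1 - t) *\<^sub>R a + t *\<^sub>R b) \<le> ereal (1 - t) * h a + ereal t * h b"
      using assms(2) that by (simp add: convex_fun_def)
    also have "\<dots> = ereal ((1 - t) * real_of_ereal (h a) + t * real_of_ereal (h b))"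
      by (subst (1 2) edom_real[OF assms(1)]) (use that in auto)
    finally have le: "h ((1 - t) *\<^sub>R a + t *\<^sub>R b)
        \<le> ereal ((1 - t) * real_of_ereal (h a) + t * real_of_ereal (h b))" .
    then have "(1 - t) *\<^sub>R a + t *\<^sub>R b \<in> edom h"
      by (auto simp: edom_def intro: le_less_trans)
    with le show ?thesis
      using edom_real[OF assms(1)] by (metis ereal_less_eq(3))
  qed
  have "convex (edom h)"
    unfolding convex_alt
  proof (intro ballI allI impI)
    fix a b and t :: real
    assume "a \<in> edom h" "b \<in> edom h" "0 \<le> t \<and> t \<le> 1"
    \<comment> \<open>\<open>convex_fun\<close> speaks only of \<open>t\<close> strictly between 0
      and 1; the end points are trivial.\<close>
    then show "(1 - t) *\<^sub>R a + t *\<^sub>R b \<in> edom h"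
      using *[of a b t] by (cases "t = 0 \<or> t = 1") auto
  qed
  then show ?thesis
    by (intro convex_onI) (use * in auto)
qed

text \<open>\<open>Liminf (at p)\<close> ignores the value at \<open>p\<close> itself, while a
  sequence tending to \<open>p\<close> may hit \<open>p\<close>; the hypothesis
  \<open>c < h p\<close> supplies the missing point.\<close>

lemma lsc_fun_eventually:
  assumes "lsc_fun h" "c < h p"
  shows "eventually (\<lambda>y. c < h y) (nhds p)"
proof -
  have "eventually (\<lambda>y. c < h y) (at p)"
    using assms by (auto simp: lsc_fun_def le_Liminf_iff)
  then show ?thesis
    unfolding eventually_at_filter by (rule eventually_mono) (use assms(2) in auto)
qed

section \<open>The proximal operator: existence, uniqueness, optimality condition\<close>

text \<open>The parallelogram law for \<open>a - z\<close> and \<open>b - z\<close>. The negative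
  term is the strong convexity of the quadratic.\<close>

lemma norm_midpoint:
  fixes a b z :: "'a::real_inner"
  shows "(norm ((1/2) *\<^sub>R a + (1/2) *\<^sub>R b - z))\<^sup>2
    = ((norm (a - z))\<^sup>2 + (norm (b - z))\<^sup>2) / 2 - (norm (a - b))\<^sup>2 / 4"
  unfolding power2_norm_eq_inner
  by (simp add: inner_diff_left inner_diff_right inner_add_left inner_add_right
      inner_commute field_simps)

text \<open>Strong convexity of the proximal objective makes minimizing sequences Cauchy, so
  existence needs no weak compactness.\<close>

lemma prox_in_minimizers:
  fixes g :: "'a::{real_inner, complete_space} \<Rightarrow> ereal"
  assumes g: "proper_fun g" "lsc_fun g" "convex_fun g"
    and minorant: "\<And>y. ereal (c + v \<bullet> y) \<le> g y"
    and "\<alpha> > 0"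
  shows "prox \<alpha> g z \<in> minimizers (\<lambda>w. ereal \<alpha> * g w + ereal (1/2 * (norm (w - z))\<^sup>2))"
proof -
  define \<phi> where "\<phi> w = ereal \<alpha> * g w + ereal (1/2 * (norm (w - z))\<^sup>2)" for w
  define G where "G w = real_of_ereal (g w)" for w
  define \<Phi> where "\<Phi> w = \<alpha> * G w + 1/2 * (norm (w - z))\<^sup>2" for w
  have gG: "g w = ereal (G w)" if "w \<in> edom g" for w
    using edom_real[OF g(1) that] by (simp add: G_def)
  have \<phi>\<Phi>: "\<phi> w = ereal (\<Phi> w)" if "w \<in> edom g" for w
    by (simp add: \<phi>_def \<Phi>_def gG[OF that])
  have \<phi>_inf: "\<phi> w = \<infinity>" if "w \<notin> edom g" for w
    using that \<open>\<alpha> > 0\<close> by (auto simp: \<phi>_def edom_def)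
  have conv: "convex_on (edom g) G"
    unfolding G_def using convex_fun_real[OF g(1,3)] .
  have ne: "edom g \<noteq> {}" using g(1) by (simp add: proper_fun_def)
  \<comment> \<open>Completing the square: the affine minorant scaled by \<open>\<alpha>\<close>
    plus the quadratic is least at \<open>w = z - \<alpha> *\<^sub>R v\<close>, with exactly this
    value.\<close>
  have lower: "\<alpha> * c + \<alpha> * (v \<bullet> z) - \<alpha>\<^sup>2 * (norm v)\<^sup>2 / 2 \<le> \<Phi> w" if "w \<in> edom g" for w
  proof -
    have "\<alpha> * (c + v \<bullet> w) \<le> \<alpha> * G w"
      using minorant[of w] \<open>\<alpha> > 0\<close> by (simp add: gG[OF that])
    moreover have "0 \<le> (norm ((w - z) + \<alpha> *\<^sub>R v))\<^sup>2" by simp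
    then have "0 \<le> (norm (w - z))\<^sup>2 + 2 * \<alpha> * (v \<bullet> w - v \<bullet> z) + \<alpha>\<^sup>2 * (norm v)\<^sup>2"
      unfolding power2_norm_eq_inner
      by (simp add: inner_diff_left inner_diff_right inner_add_left inner_add_right
          inner_commute algebra_simps power2_eq_square)
    ultimately show ?thesis by (simp add: \<Phi>_def algebra_simps)
  qed
  define m where "m = (INF w\<in>edom g. \<Phi> w)"
  have bdd: "bdd_below (\<Phi> ` edom g)"
    using lower by (auto intro!: bdd_belowI2)
  have m_le: "m \<le> \<Phi> w" if "w \<in> edom g" for w
    unfolding m_def using bdd that by (rule cINF_lower)
  \<comment> \<open>Strong convexity at the midpoint: \<open>m\<close> is at most the mean of
    \<open>\<Phi> a\<close> and \<open>\<Phi> b\<close> minus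
    \<open>(norm (a - b))\<^sup>2 / 8\<close>. This serves both the Cauchy property and
    uniqueness.\<close>
  have gap: "(norm (a - b))\<^sup>2 \<le> 4 * ((\<Phi> a - m) + (\<Phi> b - m))"
    if ab: "a \<in> edom g" "b \<in> edom g" for a b
  proof -
    let ?c = "(1/2) *\<^sub>R a + (1/2) *\<^sub>R b"
    have "?c \<in> edom g"
      using convexD[OF convex_on_imp_convex[OF conv] ab, of "1/2" "1/2"] by simp
    then have "m \<le> \<Phi> ?c" by (rule m_le)
    moreover have "G ?c \<le> (G a + G b) / 2"
      using convex_onD[OF conv, of "1/2" a b] ab by (simp add: field_simps)
    then have "\<alpha> * G ?c \<le> \<alpha> * ((G a + G b) / 2)"
      using \<open>\<alpha> > 0\<close> by (intro mult_left_mono) auto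
    ultimately show ?thesis
      by (simp add: \<Phi>_def norm_midpoint field_simps)
  qed
  have "\<exists>w\<in>edom g. \<Phi> w < m + 1 / real (Suc n)" for n
    using cINF_less_iff[OF ne bdd, of "m + 1 / real (Suc n)"] by (simp add: m_def)
  then obtain y where y: "\<And>n. y n \<in> edom g" "\<And>n. \<Phi> (y n) < m + 1 / real (Suc n)"
    by metis
  have "Cauchy y"
    unfolding Cauchy_altdef2
  proof (intro allI impI)
    fix e :: real assume "e > 0"
    \<comment> \<open>Two values of \<open>\<Phi>\<close> less than \<open>e\<^sup>2 / 8\<close>
      above \<open>m\<close> give, through \<open>gap\<close>, a squared distance below
      \<open>e\<^sup>2\<close>.\<close>
    then have "e\<^sup>2 / 8 > 0" by simp
    then obtain N where N: "1 / real (Suc N) < e\<^sup>2 / 8"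
      using nat_approx_posE by blast
    have "dist (y n) (y N) < e" if "n \<ge> N" for n
    proof -
      have "1 / real (Suc n) \<le> 1 / real (Suc N)" using that by (simp add: frac_le)
      then have "(dist (y n) (y N))\<^sup>2 < e\<^sup>2"
        using gap[OF y(1)[of n] y(1)[of N]] y(2)[of n] y(2)[of N] N by (simp add: dist_norm)
      then show ?thesis using \<open>e > 0\<close> by (simp add: power2_less_imp_less)
    qed
    then show "\<exists>N. \<forall>n\<ge>N. dist (y n) (y N) < e" by blast
  qed
  then obtain p where p: "y \<longlonglongrightarrow> p" using Cauchy_convergent_iff convergent_def by blast
  have "(\<lambda>n. \<Phi> (y n)) \<longlonglongrightarrow> m"
  proof (rule tendsto_sandwich[of "\<lambda>_. m" _ _ "\<lambda>n. m + 1 / real (Suc n)"])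
    show "(\<lambda>n. m + 1 / real (Suc n)) \<longlonglongrightarrow> m"
      using tendsto_add[OF tendsto_const[of m] LIMSEQ_Suc[OF lim_1_over_n[where 'a=real]]] by simp
  qed (use m_le y in \<open>auto intro!: always_eventually less_imp_le\<close>)
  \<comment> \<open>The limits of \<open>\<Phi>\<close> and of its quadratic part are known, so
    solving for \<open>G\<close> gives the limit of \<open>g\<close> along \<open>y\<close>; lower
    semicontinuity then bounds \<open>g p\<close> by it.\<close>
  then have "(\<lambda>n. (\<Phi> (y n) - 1/2 * (norm (y n - z))\<^sup>2) / \<alpha>)
      \<longlonglongrightarrow> (m - 1/2 * (norm (p - z))\<^sup>2) / \<alpha>"
    by (intro tendsto_intros p) (use \<open>\<alpha> > 0\<close> in auto)
  moreover have "(\<Phi> (y n) - 1/2 * (norm (y n - z))\<^sup>2) / \<alpha> = G (y n)" for n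
    using \<open>\<alpha> > 0\<close> by (simp add: \<Phi>_def)
  ultimately have limG: "(\<lambda>n. g (y n)) \<longlonglongrightarrow> ereal ((m - 1/2 * (norm (p - z))\<^sup>2) / \<alpha>)"
    by (simp add: gG y)
  have gp: "g p \<le> ereal ((m - 1/2 * (norm (p - z))\<^sup>2) / \<alpha>)"
  proof (rule ccontr)
    assume "\<not> ?thesis"
    then obtain c where c: "ereal ((m - 1/2 * (norm (p - z))\<^sup>2) / \<alpha>) < c" "c < g p"
      using dense not_le by metis
    have "eventually (\<lambda>n. c < g (y n)) sequentially"
      using lsc_fun_eventually[OF g(2) c(2)] p unfolding filterlim_iff by blast
    moreover have "eventually (\<lambda>n. g (y n) < c) sequentially"
      using order_tendstoD(2)[OF limG c(1)] .
    ultimately have "eventually (\<lambda>n. False) sequentially"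
      by eventually_elim auto
    then show False by simp
  qed
  then have p_dom: "p \<in> edom g" by (auto simp: edom_def intro: le_less_trans)
  have "\<Phi> p \<le> m"
    using gp \<open>\<alpha> > 0\<close> by (simp add: gG[OF p_dom] \<Phi>_def field_simps)
  then have p_min: "p \<in> minimizers \<phi>"
    unfolding minimizers_def using m_le \<phi>\<Phi> \<phi>_inf p_dom
    by (smt (verit, best) ereal_less_eq(1,3) mem_Collect_eq)
  \<comment> \<open>\<open>prox\<close> is a definite description, so uniqueness is needed too: by
    \<open>gap\<close>, two points with value at most \<open>m\<close> coincide.\<close>
  have "q = p" if "q \<in> minimizers \<phi>" for q
  proof -
    have le: "\<phi> q \<le> ereal (\<Phi> p)"
      using that \<phi>\<Phi>[OF p_dom] by (metis (mono_tags, lifting) mem_Collect_eq minimizers_def)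
    then have q: "q \<in> edom g" using \<phi>_inf by fastforce
    then have "\<Phi> q \<le> m" using le \<phi>\<Phi> \<open>\<Phi> p \<le> m\<close> by simp
    then have "(norm (q - p))\<^sup>2 \<le> 0"
      using gap[OF q p_dom] \<open>\<Phi> p \<le> m\<close> by argo
    then show ?thesis by simp
  qed
  with p_min have "(THE y. y \<in> minimizers \<phi>) \<in> minimizers \<phi>"
    by (metis theI)
  then show ?thesis by (simp add: prox_def \<phi>_def[abs_def])
qed

text \<open>First-order optimality: \<open>(z - p) / \<alpha>\<close> is a subgradient of
  \<open>g\<close> at \<open>p\<close>. The objective at \<open>p\<close> is compared with its
  values on the segment from \<open>p\<close> to \<open>w\<close>, the difference is divided by the
  parameter \<open>t\<close>, and \<open>t\<close> tends to 0.\<close>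

lemma minimizer_prox_objective_inequality:
  fixes g :: "'a::real_inner \<Rightarrow> ereal"
  assumes g: "proper_fun g" "convex_fun g" and "\<alpha> > 0"
    and p: "p \<in> edom g" "p \<in> minimizers (\<lambda>w. ereal \<alpha> * g w + ereal (1/2 * (norm (w - z))\<^sup>2))"
    and w: "w \<in> edom g"
  shows "(z - p) \<bullet> (w - p) \<le> \<alpha> * (real_of_ereal (g w) - real_of_ereal (g p))"
proof -
  define G where "G w = real_of_ereal (g w)" for w
  have gG: "g w = ereal (G w)" if "w \<in> edom g" for w
    using edom_real[OF g(1) that] by (simp add: G_def)
  have conv: "convex_on (edom g) G"
    unfolding G_def using convex_fun_real[OF g] .
  have *: "(z - p) \<bullet> (w - p) - \<alpha> * (G w - G p) \<le> t * ((norm (w - p))\<^sup>2 / 2)"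
    if t: "0 < t" "t < 1" for t
  proof -
    let ?q = "(1 - t) *\<^sub>R p + t *\<^sub>R w"
    have q: "?q \<in> edom g"
      using convexD[OF convex_on_imp_convex[OF conv] p(1) w, of "1 - t" t] t by simp
    have "\<alpha> * G p + 1/2 * (norm (p - z))\<^sup>2 \<le> \<alpha> * G ?q + 1/2 * (norm (?q - z))\<^sup>2"
      using p(2) unfolding minimizers_def
      by (auto dest!: spec[of _ ?q] simp: gG[OF p(1)] gG[OF q])
    moreover have "\<alpha> * G ?q \<le> \<alpha> * ((1 - t) * G p + t * G w)"
      using convex_onD[OF conv, of t p w] p(1) w t \<open>\<alpha> > 0\<close> by (intro mult_left_mono) auto
    moreover have "?q - z = (p - z) + t *\<^sub>R (w - p)" by (simp add: algebra_simps)
    then have "(norm (?q - z))\<^sup>2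
        = (norm (p - z))\<^sup>2 - 2 * t * ((z - p) \<bullet> (w - p)) + t\<^sup>2 * (norm (w - p))\<^sup>2"
      unfolding power2_norm_eq_inner
      by (simp add: inner_diff_left inner_diff_right inner_add_left inner_add_right
          inner_commute algebra_simps power2_eq_square)
    ultimately have "t * ((z - p) \<bullet> (w - p) - \<alpha> * (G w - G p)) \<le> t * (t * ((norm (w - p))\<^sup>2 / 2))"
      by (simp add: algebra_simps power2_eq_square)
    then show ?thesis using t(1) by simp
  qed
  have "((\<lambda>t. t * ((norm (w - p))\<^sup>2 / 2)) \<longlongrightarrow> 0 * ((norm (w - p))\<^sup>2 / 2)) (at_right 0)"
    by (intro tendsto_intros)
  then have "(z - p) \<bullet> (w - p) - \<alpha> * (G w - G p) \<le> 0 * ((norm (w - p))\<^sup>2 / 2)"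
    by (rule tendsto_lowerbound)
      (use * in \<open>auto intro!: eventually_at_rightI[of 0 1]\<close>)
  then show ?thesis by (simp add: G_def)
qed

section \<open>The estimate for a single iteration\<close>

lemma subdiff_real:
  assumes "proper_fun h" "y \<in> edom h" "w \<in> edom h" "v \<in> subdiff h y"
  shows "real_of_ereal (h y) + v \<bullet> (w - y) \<le> real_of_ereal (h w)"
proof -
  have "h y + ereal (v \<bullet> (w - y)) \<le> h w" using assms(4) by (simp add: subdiff_def)
  then show ?thesis
    using edom_real[OF assms(1,2)] edom_real[OF assms(1,3)]
    by (metis ereal_less_eq(3) plus_ereal.simps(1))
qed

text \<open>The optimality condition involves \<open>g p\<close>, but the bound is stated with
  \<open>g y\<close>. The bounded subgradient \<open>r\<close> of \<open>g\<close> at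
  \<open>y\<close> exchanges the two and leaves the cross term
  \<open>2 * \<alpha> * ((v + r) \<bullet> (y - p))\<close>, which is paid for by
  \<open>- (norm (y - p))\<^sup>2\<close> from the expanded square.\<close>

lemma pss_step:
  fixes f g :: "'a::{real_inner, complete_space} \<Rightarrow> ereal"
  assumes f: "proper_fun f"
    and g: "proper_fun g" "lsc_fun g" "convex_fun g"
    and dom: "edom g \<subseteq> edom f"
    and A2: "assumption_A2 g \<rho>"
    and "\<alpha> > 0" and y: "y \<in> edom g" and v: "v \<in> subdiff f y" and s: "s \<in> edom g"
    and p: "p = prox \<alpha> g (y - \<alpha> *\<^sub>R v)" "p \<in> edom g"
  shows "(norm (p - s))\<^sup>2 \<le> (norm (y - s))\<^sup>2
    + 2 * \<alpha> * ((real_of_ereal (f s) + real_of_ereal (g s))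
              - (real_of_ereal (f y) + real_of_ereal (g y)))
    + (\<alpha> * (norm v + \<rho>))\<^sup>2"
proof -
  obtain r where r: "r \<in> subdiff g y" "norm r \<le> \<rho>"
    using A2 y by (fastforce simp: assumption_A2_def)
  \<comment> \<open>The same subgradient \<open>r\<close> yields the affine minorant from which
    existence of the proximal point follows.\<close>
  have minorant: "ereal (real_of_ereal (g y) - r \<bullet> y + r \<bullet> w) \<le> g w" for w
  proof -
    have "g y + ereal (r \<bullet> (w - y)) \<le> g w" using r(1) by (simp add: subdiff_def)
    then show ?thesis
      by (subst (asm) edom_real[OF g(1) y]) (simp add: inner_diff_right algebra_simps)
  qed
  have "(y - \<alpha> *\<^sub>R v - p) \<bullet> (s - p) \<le> \<alpha> * (real_of_ereal (g s) - real_of_ereal (g p))"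
    using minimizer_prox_objective_inequality[OF g(1,3) \<open>\<alpha> > 0\<close> p(2) _ s]
      prox_in_minimizers[OF g minorant \<open>\<alpha> > 0\<close>] p(1) by blast
  moreover have "\<alpha> * (real_of_ereal (g y) + r \<bullet> (p - y)) \<le> \<alpha> * real_of_ereal (g p)"
    using subdiff_real[OF g(1) y p(2) r(1)] \<open>\<alpha> > 0\<close> by simp
  moreover have "\<alpha> * (real_of_ereal (f y) + v \<bullet> (s - y)) \<le> \<alpha> * real_of_ereal (f s)"
    using subdiff_real[OF f _ _ v, of s] y s dom \<open>\<alpha> > 0\<close> by auto
  moreover have "(norm (p - s))\<^sup>2 = (norm (y - s))\<^sup>2 - (norm (y - p))\<^sup>2 + 2 * ((y - p) \<bullet> (s - p))"
    unfolding power2_norm_eq_inner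
    by (simp add: inner_diff_left inner_diff_right inner_commute)
  \<comment> \<open>Young's inequality, weighted so that \<open>(norm (y - p))\<^sup>2\<close>
    cancels exactly.\<close>
  moreover have "0 \<le> (norm ((y - p) - \<alpha> *\<^sub>R (v + r)))\<^sup>2" by simp
  then have "2 * \<alpha> * ((v + r) \<bullet> (y - p)) \<le> (norm (y - p))\<^sup>2 + (\<alpha> * norm (v + r))\<^sup>2"
    unfolding power_mult_distrib power2_norm_eq_inner
    by (simp add: inner_diff_left inner_diff_right inner_add_left inner_add_right
        inner_commute algebra_simps power2_eq_square)
  moreover have "(\<alpha> * norm (v + r))\<^sup>2 \<le> (\<alpha> * (norm v + \<rho>))\<^sup>2"
    using \<open>\<alpha> > 0\<close> r(2) norm_triangle_ineq[of v r]
    by (intro power_mono mult_left_mono) auto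
  ultimately show ?thesis
    by (simp add: inner_diff_left inner_diff_right inner_add_left algebra_simps)
qed

section \<open>Rates for the best value and the ergodic sequence\<close>

theorem corollary2p8:
  fixes f g :: "'a::{real_inner, complete_space} \<Rightarrow> ereal"
    and x u :: "nat \<Rightarrow> 'a"
    and \<alpha> \<beta> :: "nat \<Rightarrow> real"
    and \<zeta> \<rho> :: real
    and V S :: "'a set"
  assumes nontrivial: "\<exists>z::'a. z \<noteq> 0"
    and f: "proper_fun f" "lsc_fun f" "convex_fun f"
    and g: "proper_fun g" "lsc_fun g" "convex_fun g"
    and dom: "edom g \<subseteq> edom f"
    and A1: "assumption_A1 f g"
    and A2: "assumption_A2 g \<rho>"
    and pss: "pss_method f g \<alpha> u x"
    and steps: "exogenous_stepsizes \<alpha> \<beta> u"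
    and V: "bounded V" "closed V" "V \<subseteq> edom g" "range x \<subseteq> V"
    and zeta: "subdiff_bound f V \<zeta>" "\<zeta> \<ge> 1"
    and S: "S = minimizers (\<lambda>y. f y + g y)" "S \<noteq> {}"
  shows "\<forall>k.
      best_value (\<lambda>y. f y + g y) x k - (INF y. f y + g y)
        \<le> ereal (\<zeta> * (((infdist (x 0) S)\<^sup>2 + (1 + 2 * \<rho> + \<rho>\<^sup>2) * (\<Sum>i=0..k. (\<beta> i)\<^sup>2))
                     / (2 * (\<Sum>i=0..k. \<beta> i))))
    \<and> (f (ergodic \<alpha> x k) + g (ergodic \<alpha> x k)) - (INF y. f y + g y)
        \<le> ereal (\<zeta> * (((infdist (x 0) S)\<^sup>2 + (1 + 2 * \<rho> + \<rho>\<^sup>2) * (\<Sum>i=0..k. (\<beta> i)\<^sup>2))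
                     / (2 * (\<Sum>i=0..k. \<beta> i))))"
proof -
  \<comment> \<open>\<open>real_of_ereal\<close> sends infinity to 0, so \<open>F\<close> represents
    \<open>f + g\<close> only on \<open>edom g\<close>; every use below stays there.\<close>
  define F where "F y = real_of_ereal (f y) + real_of_ereal (g y)" for y
  have FF: "f y + g y = ereal (F y)" if "y \<in> edom g" for y
    using edom_real[OF f(1), of y] edom_real[OF g(1) that] dom that
    by (metis F_def plus_ereal.simps(1) subsetD)
  have xdom: "x k \<in> edom g" for k using V(3,4) by blast
  have F_conv: "convex_on (edom g) F"
    unfolding F_def
    by (intro convex_on_add convex_fun_real g convex_on_subset[OF convex_fun_real[OF f(1,3)] dom]
        convex_on_imp_convex[OF convex_fun_real[OF g(1,3)]])
  have \<alpha>_pos: "\<alpha> k > 0" and \<alpha>_def: "\<alpha> k = \<beta> k / max 1 (norm (u k))" for k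
    using steps unfolding exogenous_stepsizes_def by blast+
  have \<beta>_eq: "\<beta> k = \<alpha> k * max 1 (norm (u k))" for k by (simp add: \<alpha>_def)
  have \<beta>_pos: "\<beta> k > 0" for k unfolding \<beta>_eq using \<alpha>_pos[of k] by (intro mult_pos_pos) auto
  have u: "u k \<in> subdiff f (x k)" and x_Suc: "x (Suc k) = prox (\<alpha> k) g (x k - \<alpha> k *\<^sub>R u k)" for k
    using pss unfolding pss_method_def by blast+
  have \<rho>: "\<rho> \<ge> 0" using A2 by (simp add: assumption_A2_def)
  \<comment> \<open>Here \<open>\<zeta> \<ge> 1\<close> enters: it lets
    \<open>max 1 (norm (u k))\<close> be bounded by \<open>\<zeta>\<close> itself.\<close>
  have \<beta>_le: "\<beta> k \<le> \<zeta> * \<alpha> k" for k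
  proof -
    have "norm (u k) \<le> \<zeta>"
      using zeta(1) u[of k] V(4) by (fastforce simp: subdiff_bound_def)
    then show ?thesis
      unfolding \<beta>_eq using zeta(2) \<alpha>_pos[of k] by (simp add: mult.commute)
  qed
  have S_dom: "s \<in> edom g" if "s \<in> S" for s
  proof -
    have "f s + g s \<le> f (x 0) + g (x 0)" using that S(1) by (simp add: minimizers_def)
    also have "\<dots> < \<infinity>" by (simp add: FF[OF xdom])
    finally show ?thesis by (simp add: edom_def)
  qed
  have INF_eq: "(INF y. f y + g y) = ereal (F s)" if "s \<in> S" for s
  proof (rule INF_eqI)
    show "ereal (F s) \<le> f y + g y" for y
      using that S(1) FF[OF S_dom[OF that]] by (simp add: minimizers_def)
  qed (metis FF[OF S_dom[OF that]] UNIV_I)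
  obtain s0 where s0: "s0 \<in> S" using S(2) by blast
  have F_min: "F s0 \<le> F y" if "y \<in> edom g" for y
    using INF_lower[of y UNIV "\<lambda>y. f y + g y"] by (simp add: INF_eq[OF s0] FF[OF that])
  have F_eq: "F s = F s0" if "s \<in> S" for s
    using INF_eq[OF that] INF_eq[OF s0] by simp
  have step: "(norm (x (Suc k) - s))\<^sup>2
      \<le> (norm (x k - s))\<^sup>2 - 2 * \<alpha> k * (F (x k) - F s0) + (1 + 2 * \<rho> + \<rho>\<^sup>2) * (\<beta> k)\<^sup>2"
    if "s \<in> S" for s k
  proof -
    \<comment> \<open>The maximum is at least 1, so it may multiply \<open>\<rho>\<close>. Then
      \<open>\<alpha> k\<close> times the maximum is \<open>\<beta> k\<close>, and squaring produces
      the factor \<open>(1 + \<rho>)\<^sup>2\<close>.\<close>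
    have "norm (u k) + \<rho> \<le> (1 + \<rho>) * max 1 (norm (u k))"
      using mult_left_mono[of 1 "max 1 (norm (u k))" \<rho>] \<rho> by (simp add: distrib_right)
    then have "\<alpha> k * (norm (u k) + \<rho>) \<le> \<alpha> k * ((1 + \<rho>) * max 1 (norm (u k)))"
      using \<alpha>_pos[of k] by simp
    also have "\<dots> = (1 + \<rho>) * \<beta> k" by (simp add: \<beta>_eq)
    finally have "(\<alpha> k * (norm (u k) + \<rho>))\<^sup>2 \<le> ((1 + \<rho>) * \<beta> k)\<^sup>2"
      using \<alpha>_pos[of k] \<rho> by (intro power_mono) auto
    moreover have "((1 + \<rho>) * \<beta> k)\<^sup>2 = (1 + 2 * \<rho> + \<rho>\<^sup>2) * (\<beta> k)\<^sup>2"
      by (simp add: power_mult_distrib power2_sum)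
    moreover have "(norm (x (Suc k) - s))\<^sup>2
        \<le> (norm (x k - s))\<^sup>2 + 2 * \<alpha> k * (F s0 - F (x k)) + (\<alpha> k * (norm (u k) + \<rho>))\<^sup>2"
      using pss_step[OF f(1) g dom A2 \<alpha>_pos xdom u S_dom[OF that] x_Suc xdom, of k]
      by (simp flip: F_def add: F_eq[OF that])
    ultimately show ?thesis by (simp add: right_diff_distrib)
  qed
  have sum_bound: "2 * (\<Sum>i=0..k. \<alpha> i * (F (x i) - F s0))
      \<le> (infdist (x 0) S)\<^sup>2 + (1 + 2 * \<rho> + \<rho>\<^sup>2) * (\<Sum>i=0..k. (\<beta> i)\<^sup>2)" for k
  proof -
    define A where "A = 2 * (\<Sum>i=0..k. \<alpha> i * (F (x i) - F s0))
      - (1 + 2 * \<rho> + \<rho>\<^sup>2) * (\<Sum>i=0..k. (\<beta> i)\<^sup>2)"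
    have "A \<le> (dist (x 0) s)\<^sup>2" if "s \<in> S" for s
    proof -
      \<comment> \<open>Telescoping of \<open>step\<close>; dropping the nonnegative left-hand side
        then bounds \<open>A\<close>.\<close>
      have "(norm (x (Suc k) - s))\<^sup>2 \<le> (norm (x 0 - s))\<^sup>2 - A"
        unfolding A_def
      proof (induction k)
        case 0
        then show ?case using step[OF that, of 0] by simp
      next
        case (Suc k)
        then show ?case using step[OF that, of "Suc k"] by (simp add: algebra_simps)
      qed
      then show ?thesis using zero_le_power2[of "norm (x (Suc k) - s)"] unfolding dist_norm by linarith
    qed
    \<comment> \<open>No nearest point of \<open>S\<close> is used: the bound passes to the infimum
      after taking square roots, and \<open>max 0 A\<close> covers a negative
      \<open>A\<close>.\<close>
    then have "sqrt (max 0 A) \<le> dist (x 0) s" if "s \<in> S" for s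
      using that by (intro real_le_lsqrt) auto
    then have "sqrt (max 0 A) \<le> infdist (x 0) S"
      using S(2) by (auto simp: infdist_def intro: cINF_greatest)
    then have "max 0 A \<le> (infdist (x 0) S)\<^sup>2" by (rule sqrt_le_D)
    then show ?thesis by (simp add: A_def)
  qed
  \<comment> \<open>\<open>D\<close> stands for the gap of the best value or of the ergodic point.
    Since \<open>D \<ge> 0\<close>, \<open>\<beta>_le\<close> trades the sum of the
    \<open>\<alpha> i\<close> for that of the \<open>\<beta> i\<close> at the cost of a factor
    \<open>\<zeta>\<close>.\<close>
  have rate: "D \<le> \<zeta> * (((infdist (x 0) S)\<^sup>2 + (1 + 2 * \<rho> + \<rho>\<^sup>2) * (\<Sum>i=0..k. (\<beta> i)\<^sup>2))
                     / (2 * (\<Sum>i=0..k. \<beta> i)))"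
    if "D \<ge> 0" "(\<Sum>i=0..k. \<alpha> i) * D \<le> (\<Sum>i=0..k. \<alpha> i * (F (x i) - F s0))" for D k
  proof -
    have "(\<Sum>i=0..k. \<beta> i) * D \<le> (\<zeta> * (\<Sum>i=0..k. \<alpha> i)) * D"
      using \<beta>_le that(1) by (intro mult_right_mono) (auto simp: sum_distrib_left intro: sum_mono)
    also have "\<dots> \<le> \<zeta> * (\<Sum>i=0..k. \<alpha> i * (F (x i) - F s0))"
      using that(2) zeta(2) by (simp add: mult.assoc)
    finally have "2 * (\<Sum>i=0..k. \<beta> i) * D \<le> \<zeta> * (2 * (\<Sum>i=0..k. \<alpha> i * (F (x i) - F s0)))"
      by simp
    also have "\<dots> \<le> \<zeta> * ((infdist (x 0) S)\<^sup>2 + (1 + 2 * \<rho> + \<rho>\<^sup>2) * (\<Sum>i=0..k. (\<beta> i)\<^sup>2))"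
      using sum_bound[of k] zeta(2) by (intro mult_left_mono) auto
    moreover have "(\<Sum>i=0..k. \<beta> i) > 0" using \<beta>_pos by (intro sum_pos) auto
    ultimately show ?thesis by (simp add: pos_le_divide_eq mult.commute)
  qed
  show ?thesis
  proof (intro allI conjI)
    fix k
    have \<alpha>_sum: "(\<Sum>i=0..k. \<alpha> i) > 0" using \<alpha>_pos by (intro sum_pos) auto
    have "best_value (\<lambda>y. f y + g y) x k \<in> (\<lambda>i. f (x i) + g (x i)) ` {0..k}"
      unfolding best_value_def by (intro Min_in) auto
    then obtain j where j: "best_value (\<lambda>y. f y + g y) x k = ereal (F (x j))"
      using FF[OF xdom] by auto
    have best_le: "F (x j) \<le> F (x i)" if "i \<in> {0..k}" for i
    proof -
      have "best_value (\<lambda>y. f y + g y) x k \<le> f (x i) + g (x i)"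
        unfolding best_value_def using that by (intro Min_le) auto
      then show ?thesis by (simp add: j FF[OF xdom])
    qed
    \<comment> \<open>The least of the values up to \<open>k\<close> lies below their
      \<open>\<alpha>\<close>-weighted mean.\<close>
    have "F (x j) - F s0 \<le> \<zeta> * (((infdist (x 0) S)\<^sup>2 + (1 + 2 * \<rho> + \<rho>\<^sup>2) * (\<Sum>i=0..k. (\<beta> i)\<^sup>2))
                     / (2 * (\<Sum>i=0..k. \<beta> i)))"
    proof (rule rate)
      show "(\<Sum>i=0..k. \<alpha> i) * (F (x j) - F s0) \<le> (\<Sum>i=0..k. \<alpha> i * (F (x i) - F s0))"
        unfolding sum_distrib_right using best_le less_imp_le[OF \<alpha>_pos]
        by (intro sum_mono mult_left_mono) auto
    qed (simp add: F_min[OF xdom])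
    then show "best_value (\<lambda>y. f y + g y) x k - (INF y. f y + g y)
        \<le> ereal (\<zeta> * (((infdist (x 0) S)\<^sup>2 + (1 + 2 * \<rho> + \<rho>\<^sup>2) * (\<Sum>i=0..k. (\<beta> i)\<^sup>2))
                     / (2 * (\<Sum>i=0..k. \<beta> i))))"
      by (simp add: j INF_eq[OF s0])
    \<comment> \<open>Normalized stepsizes exhibit the ergodic point as a convex combination of
      iterates, so it stays in the convex set \<open>edom g\<close> and Jensen's inequality
      applies.\<close>
    define w where "w i = \<alpha> i / (\<Sum>i=0..k. \<alpha> i)" for i
    have w: "(\<Sum>i=0..k. w i) = 1" "\<And>i. w i \<ge> 0"
      using \<alpha>_sum less_imp_le[OF \<alpha>_pos] by (auto simp: w_def simp flip: sum_divide_distrib)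
    have erg: "ergodic \<alpha> x k = (\<Sum>i=0..k. w i *\<^sub>R x i)"
      by (simp add: ergodic_def w_def scaleR_sum_right)
    have erg_dom: "ergodic \<alpha> x k \<in> edom g"
      unfolding erg by (intro convex_sum convex_on_imp_convex[OF F_conv] w xdom) auto
    have "F (ergodic \<alpha> x k) \<le> (\<Sum>i=0..k. w i * F (x i))"
      unfolding erg by (rule convex_on_sum[OF _ _ F_conv]) (use w xdom in auto)
    then have "(\<Sum>i=0..k. \<alpha> i) * F (ergodic \<alpha> x k) \<le> (\<Sum>i=0..k. \<alpha> i) * (\<Sum>i=0..k. w i * F (x i))"
      using \<alpha>_sum by simp
    also have "\<dots> = (\<Sum>i=0..k. \<alpha> i * F (x i))"
      using \<alpha>_sum by (simp add: w_def flip: sum_divide_distrib)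
    finally have jensen: "(\<Sum>i=0..k. \<alpha> i) * F (ergodic \<alpha> x k) \<le> (\<Sum>i=0..k. \<alpha> i * F (x i))" .
    have "F (ergodic \<alpha> x k) - F s0
        \<le> \<zeta> * (((infdist (x 0) S)\<^sup>2 + (1 + 2 * \<rho> + \<rho>\<^sup>2) * (\<Sum>i=0..k. (\<beta> i)\<^sup>2))
                     / (2 * (\<Sum>i=0..k. \<beta> i)))"
    proof (rule rate)
      show "(\<Sum>i=0..k. \<alpha> i) * (F (ergodic \<alpha> x k) - F s0) \<le> (\<Sum>i=0..k. \<alpha> i * (F (x i) - F s0))"
        using jensen by (simp add: right_diff_distrib sum_subtractf sum_distrib_right)
    qed (simp add: F_min[OF erg_dom])
    then show "(f (ergodic \<alpha> x k) + g (ergodic \<alpha> x k)) - (INF y. f y + g y)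
        \<le> ereal (\<zeta> * (((infdist (x 0) S)\<^sup>2 + (1 + 2 * \<rho> + \<rho>\<^sup>2) * (\<Sum>i=0..k. (\<beta> i)\<^sup>2))
                     / (2 * (\<Sum>i=0..k. \<beta> i))))"
      by (simp add: FF[OF erg_dom] INF_eq[OF s0])
  qed
qed

end
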